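(* Assume $0<q\le1$; in case $q=1$, assume also $X_{+,1}\neq\emptyset$. Let $$\Lambda=\sup\{\lambda>0:\ \text{for each }u\in X_{+,q},\ \phi_u(t)\text{ has two critical points in }(0,\infty)\}.$$ Then $\Lambda>0$.
   Context: Let $s\in(0,1)$, $n>2s$, $\Omega\subset\mathbb{R}^n$ a bounded domain with smooth boundary, $2^*_s=\frac{2n}{n-2s}$, $\lambda>0$, and $a\in L^\infty(\Omega)$ with $a\ge\theta$ in $\Omega$ for some constant $\theta>0$. Let $Q=\mathbb{R}^{2n}\setminus((\mathbb{R}^n\setminus\Omega)\times(\mathbb{R}^n\setminus\Omega))$. $X$ is the space of measurable $u:\mathbb{R}^n\to\mathbb{R}$ with $u|_\Omega\in L^2(\Omega)$ and $\frac{u(x)-u(y)}{|x-y|^{n/2+s}}\in L^2(Q)$; $X_0=\{u\in X: u=0\text{ a.e. in }\mathbb{R}^n\setminus\Omega\}$ is a Hilbert space with norm $\|u\|=\big(\int_Q\frac{|u(x)-u(y)|^2}{|x-y|^{n+2s}}dxdy\big)^{1/2}$. $X_+=\{u\in X_0:u\ge0\}$. $G_q(x)=\frac{|x|^{1-q}}{1-q}$ if $0<q<1$, $G_1(x)=\ln|x|$ (with $G_1(0)=-\infty$). $X_{+,q}=\{u\in X_+: u\not\equiv0,\ G_q(u)\in L^1(\Omega)\}$. $I_\lambda:X_0\to(-\infty,\infty]$, $I_\lambda(u)=\frac12\|u\|^2-\lambda\int_\Omega a(x)G_q(u)dx-\frac1{2^*_s}\int_\Omega|u|^{2^*_s}dx$.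 For $u\in X_{+,q}$ the fiber map is $\phi_u(t)=I_\lambda(tu)$, $t>0$ (it depends on $\lambda$). *)

theory Defs
  imports "HOL-Analysis.Analysis"
begin

text \<open>
  Functions stand for their classes modulo equality almost everywhere, so all pointwise
  conditions are imposed a.e.  Measurability and integrals are with respect to the completed
  measure \<^const>\<open>lebesgue\<close>.
\<close>

primrec Ck :: "nat \<Rightarrow> ('a::euclidean_space \<Rightarrow> real) \<Rightarrow> bool" where
  "Ck 0 f \<longleftrightarrow> continuous_on UNIV f"
| "Ck (Suc k) f \<longleftrightarrow>
     f differentiable_on UNIV \<and> (\<forall>b\<in>Basis. Ck k (\<lambda>x. frechet_derivative f (at x) b))"

definition smooth_fun :: "('a::euclidean_space \<Rightarrow> real) \<Rightarrow> bool" where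
  "smooth_fun f \<longleftrightarrow> (\<forall>k. Ck k f)"

text \<open>
  Near each boundary point the set is the part of a ball lying above the graph of a smooth
  function over the hyperplane orthogonal to a unit vector \<open>e\<close>; \<open>\<gamma>\<close> is only ever
  evaluated at orthogonal projections to that hyperplane.
\<close>

definition smooth_boundary :: "'a::euclidean_space set \<Rightarrow> bool" where
  "smooth_boundary \<Omega> \<longleftrightarrow>
     (\<forall>p\<in>frontier \<Omega>. \<exists>r>0. \<exists>e \<gamma>. norm e = 1 \<and> smooth_fun \<gamma> \<and>
        \<Omega> \<inter> ball p r = {x \<in> ball p r. \<gamma> (x - (x \<bullet> e) *\<^sub>R e) < x \<bullet> e})"

definition smooth_bounded_domain :: "'a::euclidean_space set \<Rightarrow> bool" where
  "smooth_bounded_domain \<Omega> \<longleftrightarrow>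
     open \<Omega> \<and> connected \<Omega> \<and> \<Omega> \<noteq> {} \<and> bounded \<Omega> \<and> smooth_boundary \<Omega>"

definition L2_on :: "'a::euclidean_space set \<Rightarrow> ('a \<Rightarrow> real) \<Rightarrow> bool" where
  "L2_on S f \<longleftrightarrow>
     f \<in> borel_measurable (lebesgue_on S) \<and> integrable (lebesgue_on S) (\<lambda>x. (f x)\<^sup>2)"

definition Linf_on :: "'a::euclidean_space set \<Rightarrow> ('a \<Rightarrow> real) \<Rightarrow> bool" where
  "Linf_on S f \<longleftrightarrow>
     f \<in> borel_measurable (lebesgue_on S) \<and> (\<exists>M. AE x in lebesgue_on S. \<bar>f x\<bar> \<le> M)"

definition L1_ereal :: "'a measure \<Rightarrow> ('a \<Rightarrow> ereal) \<Rightarrow> bool" where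
  "L1_ereal M g \<longleftrightarrow> g \<in> borel_measurable M \<and> (\<integral>\<^sup>+ x. e2ennreal \<bar>g x\<bar> \<partial>M) < \<infinity>"

text \<open>
  Positive part minus negative part (\<^const>\<open>e2ennreal\<close> truncates negative values to 0);
  meaningful whenever at least one of the two is finite.
\<close>

definition ereal_integral :: "'a measure \<Rightarrow> ('a \<Rightarrow> ereal) \<Rightarrow> ereal" where
  "ereal_integral M g =
     enn2ereal (\<integral>\<^sup>+ x. e2ennreal (g x) \<partial>M) - enn2ereal (\<integral>\<^sup>+ x. e2ennreal (- g x) \<partial>M)"

definition Q_set :: "'a::euclidean_space set \<Rightarrow> ('a \<times> 'a) set" where
  "Q_set \<Omega> = UNIV - ((UNIV - \<Omega>) \<times> (UNIV - \<Omega>))"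

definition X_space :: "real \<Rightarrow> 'a::euclidean_space set \<Rightarrow> ('a \<Rightarrow> real) set" where
  "X_space s \<Omega> = {u. u \<in> borel_measurable lebesgue \<and> L2_on \<Omega> u \<and>
     L2_on (Q_set \<Omega>) (\<lambda>(x, y). (u x - u y) / norm (x - y) powr (real DIM('a) / 2 + s))}"

definition X0_space :: "real \<Rightarrow> 'a::euclidean_space set \<Rightarrow> ('a \<Rightarrow> real) set" where
  "X0_space s \<Omega> = {u \<in> X_space s \<Omega>. AE x in lebesgue_on (UNIV - \<Omega>). u x = 0}"

definition X0_norm :: "real \<Rightarrow> 'a::euclidean_space set \<Rightarrow> ('a \<Rightarrow> real) \<Rightarrow> real" where
  "X0_norm s \<Omega> u = sqrt (integral\<^sup>L (lebesgue_on (Q_set \<Omega>))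
     (\<lambda>(x, y). \<bar>u x - u y\<bar>\<^sup>2 / norm (x - y) powr (real DIM('a) + 2 * s)))"

definition X_plus :: "real \<Rightarrow> 'a::euclidean_space set \<Rightarrow> ('a \<Rightarrow> real) set" where
  "X_plus s \<Omega> = {u \<in> X0_space s \<Omega>. AE x in lebesgue. 0 \<le> u x}"

definition G :: "real \<Rightarrow> real \<Rightarrow> ereal" where
  "G q x = (if q = 1 then (if x = 0 then -\<infinity> else ereal (ln \<bar>x\<bar>))
            else ereal (\<bar>x\<bar> powr (1 - q) / (1 - q)))"

definition X_plus_q :: "real \<Rightarrow> 'a::euclidean_space set \<Rightarrow> real \<Rightarrow> ('a \<Rightarrow> real) set" where
  "X_plus_q s \<Omega> q = {u \<in> X_plus s \<Omega>.
     \<not> (AE x in lebesgue. u x = 0) \<and> L1_ereal (lebesgue_on \<Omega>) (\<lambda>x. G q (u x))}"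

definition crit_exp :: "nat \<Rightarrow> real \<Rightarrow> real" where
  "crit_exp n s = 2 * real n / (real n - 2 * s)"

text \<open>
  The last integral is taken in \<open>[0, \<infinity>]\<close>, so its finiteness on \<^const>\<open>X0_space\<close>
  (the fractional Sobolev embedding) is not built into the definition.
\<close>

definition I_functional ::
  "real \<Rightarrow> 'a::euclidean_space set \<Rightarrow> ('a \<Rightarrow> real) \<Rightarrow> real \<Rightarrow> real \<Rightarrow> ('a \<Rightarrow> real) \<Rightarrow> ereal" where
  "I_functional s \<Omega> a q lam u =
     ereal (1 / 2 * (X0_norm s \<Omega> u)\<^sup>2)
     - ereal lam * ereal_integral (lebesgue_on \<Omega>) (\<lambda>x. ereal (a x) * G q (u x))
     - ereal (1 / crit_exp DIM('a) s)
       * enn2ereal (\<integral>\<^sup>+ x. ennreal (\<bar>u x\<bar> powr crit_exp DIM('a) s) \<partial>lebesgue_on \<Omega>)"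

definition fiber_map ::
  "real \<Rightarrow> 'a::euclidean_space set \<Rightarrow> ('a \<Rightarrow> real) \<Rightarrow> real \<Rightarrow> real \<Rightarrow> ('a \<Rightarrow> real) \<Rightarrow> real \<Rightarrow> ereal" where
  "fiber_map s \<Omega> a q lam u t = I_functional s \<Omega> a q lam (\<lambda>x. t * u x)"

text \<open>
  \<^const>\<open>real_of_ereal\<close> sends infinite values to 0, hence the explicit finiteness near \<open>t\<close>.
\<close>

definition critical_point :: "(real \<Rightarrow> ereal) \<Rightarrow> real \<Rightarrow> bool" where
  "critical_point \<phi> t \<longleftrightarrow>
     (\<forall>\<^sub>F r in nhds t. \<bar>\<phi> r\<bar> \<noteq> \<infinity>) \<and> ((\<lambda>r. real_of_ereal (\<phi> r)) has_real_derivative 0) (at t)"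

text \<open>
  The supremum is taken in the extended reals; it would be \<open>-\<infinity>\<close> for an empty set.
  ``Two'' is read as ``exactly two''.
\<close>

definition Lambda_sup ::
  "real \<Rightarrow> 'a::euclidean_space set \<Rightarrow> ('a \<Rightarrow> real) \<Rightarrow> real \<Rightarrow> ereal" where
  "Lambda_sup s \<Omega> a q = Sup {ereal lam | lam. lam > 0 \<and>
     (\<forall>u\<in>X_plus_q s \<Omega> q. card {t \<in> {0<..}. critical_point (fiber_map s \<Omega> a q lam u) t} = 2)}"

end

theory Submission
  imports Defs
begin

text \<open>
  For \<open>u\<close> in \<open>X_plus_q\<close> put \<open>p = 2n / (n - 2s)\<close>, \<open>N = \<parallel>u\<parallel>\<^sup>2\<close>, \<open>A = \<integral> a \<bar>u\<bar>^(1-q)\<close> and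
  \<open>B = \<integral> \<bar>u\<bar>\<^sup>p\<close>, integrals over \<open>\<Omega>\<close>.  For every \<open>q\<close> in \<open>(0, 1]\<close> the fiber map has the derivative
  \<open>F t = N t - \<lambda> A t^(-q) - B t^(p-1)\<close> (lemma \<open>fiber_map_critical_point_iff\<close>).  This function is
  strictly concave and negative near \<open>0\<close> and near infinity.  Hence it has exactly two zeros as
  soon as it is positive somewhere (\<open>two_zeros_of_concave_slope\<close>), and it remains to find one
  \<open>\<lambda> > 0\<close> for which this happens for all \<open>u\<close> at once.

  The fractional Sobolev inequality bounds \<open>B\<close> by a multiple of \<open>N^(p/2)\<close>, and since \<open>a\<close> is
  bounded and \<open>\<Omega>\<close> has finite measure, an inequality of Hoelder type bounds \<open>A\<close> by a multiple of
  \<open>B\<close> to the power \<open>(1 - q) / p\<close> (\<open>lower_power_integral_le\<close>).  At \<open>t = c N^(-1/2)\<close> all three terms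
  of \<open>F\<close> then scale like \<open>N^(1/2)\<close>, so a small \<open>c\<close> followed by a small \<open>\<lambda>\<close>, both independent of
  \<open>u\<close>, make \<open>F\<close> positive there (\<open>slope_positive_for_uniform_parameter\<close>).

  The Sobolev inequality (\<open>fractional_sobolev\<close>) is proved directly.  If \<open>w \<ge> 0\<close> takes the value
  \<open>h\<close> at \<open>x\<close>, then, by Markov's inequality, \<open>w\<close> is below \<open>h / 2\<close> on half of a ball around \<open>x\<close>
  whose volume is comparable with \<open>h^(-p) \<integral> w\<^sup>p\<close>.  This forces the inner integral
  \<open>\<integral> \<bar>w x - w y\<bar>\<^sup>2 / \<bar>x - y\<bar>^(n+2s) dy\<close> to be at least a multiple of \<open>h\<^sup>p (\<integral> w\<^sup>p)^(-2s/n)\<close>.  Integrating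
  over \<open>x\<close> and absorbing the power of \<open>\<integral> w\<^sup>p\<close> gives the inequality whenever \<open>\<integral> w\<^sup>p\<close> is
  finite, and truncation establishes the finiteness.
\<close>

section \<open>The zeros of the slope of a fiber map\<close>

text \<open>
  All three terms of \<open>F\<close> are concave because \<open>q > 0\<close> and \<open>p > 2\<close>, so \<open>F'\<close> is strictly
  decreasing and Rolle's theorem excludes three zeros.  The singular term makes \<open>F\<close> negative
  near \<open>0\<close> and the critical power makes it negative far out, so one positive value gives a zero
  on each side.
\<close>

lemma two_zeros_of_concave_slope:
  fixes N A B p q t1 :: real
  defines "F \<equiv> \<lambda>t. N * t - A * t powr (-q) - B * t powr (p - 1)"
  assumes "0 < N" "0 < A" "0 < B" "0 < q" "2 < p" "0 < t1" "0 < F t1"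
  shows "card {t \<in> {0<..}. F t = 0} = 2"
proof -
  define F' where "F' t = N + q * A * t powr (-q - 1) - (p - 1) * B * t powr (p - 2)" for t
  have der: "(F has_real_derivative F' t) (at t)" if "0 < t" for t
    unfolding F_def F'_def using that
    by (auto intro!: derivative_eq_intros simp: algebra_simps)
  have F'_less: "F' y < F' x" if "0 < x" "x < y" for x y
  proof -
    have "y powr (-q - 1) < x powr (-q - 1)"
      using that assms by (intro powr_less_mono2_neg) auto
    moreover have "x powr (p - 2) < y powr (p - 2)"
      using that assms by (intro powr_less_mono2) auto
    ultimately have "q * A * y powr (-q - 1) < q * A * x powr (-q - 1)"
      "(p - 1) * B * x powr (p - 2) < (p - 1) * B * y powr (p - 2)"
      using assms by (auto intro!: mult_strict_left_mono)
    then show ?thesis unfolding F'_def by linarith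
  qed
  have diff: "F differentiable (at t)" if "0 < t" for t
    using der[OF that] by (auto simp: real_differentiable_def)
  have cont: "continuous_on {x..y} F" if "0 < x" for x y
    using that by (intro DERIV_atLeastAtMost_imp_continuous_on) (meson der less_le_trans)
  have no3: False if "0 < x" "x < y" "y < z" "F x = 0" "F y = 0" "F z = 0" for x y z
  proof -
    have "\<exists>\<xi>>x. \<xi> < y \<and> (F has_real_derivative 0) (at \<xi>)"
      by (rule Rolle) (use that cont in \<open>auto intro!: diff\<close>)
    then obtain \<xi> where \<xi>: "x < \<xi>" "\<xi> < y" "(F has_real_derivative 0) (at \<xi>)" by blast
    have "\<exists>\<eta>>y. \<eta> < z \<and> (F has_real_derivative 0) (at \<eta>)"
      by (rule Rolle) (use that cont in \<open>auto intro!: diff\<close>)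
    then obtain \<eta> where \<eta>: "y < \<eta>" "\<eta> < z" "(F has_real_derivative 0) (at \<eta>)" by blast
    have "F' \<xi> = 0" "F' \<eta> = 0"
      using \<xi> \<eta> that der DERIV_unique by (meson less_trans)+
    then show False using F'_less[of \<xi> \<eta>] \<xi> \<eta> that by auto
  qed
  \<comment> \<open>At \<open>a\<close> the first two terms of \<open>F\<close> cancel, at \<open>b\<close> the first and the third.\<close>
  define a where "a = (A / N) powr (1 / (1 + q))"
  define b where "b = (N / B) powr (1 / (p - 2))"
  have pos: "0 < a" "0 < b" using assms by (auto simp: a_def b_def)
  have Nt: "N * t = N * t powr (1 + q) * t powr (-q)"
    and Bt: "B * t powr (p - 1) = B * t powr (p - 2) * t" if "0 < t" for t
  proof -
    have "t powr (1 + q) * t powr (-q) = t"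
      using that by (simp flip: powr_add)
    then show "N * t = N * t powr (1 + q) * t powr (-q)" by (simp add: mult.assoc)
    have "t powr (p - 1) = t powr (p - 2) * t"
      using that powr_add[of t "p - 2" 1] by simp
    then show "B * t powr (p - 1) = B * t powr (p - 2) * t" by simp
  qed
  have "N * a powr (1 + q) = A"
    using assms by (simp add: a_def powr_powr)
  then have "N * a = A * a powr (-q)"
    using Nt[OF pos(1)] by simp
  then have Fa: "F a < 0" using assms pos by (simp add: F_def)
  have "B * b powr (p - 2) = N"
    using assms by (simp add: b_def powr_powr)
  then have "B * b powr (p - 1) = N * b"
    using Bt[OF pos(2)] by simp
  then have Fb: "F b < 0" using assms pos by (simp add: F_def)
  have "a < t1"
  proof (rule ccontr)
    assume "\<not> a < t1"
    then have "N * t1 powr (1 + q) \<le> N * a powr (1 + q)"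
      using assms by (intro mult_left_mono powr_mono2) auto
    then have "N * t1 powr (1 + q) * t1 powr (-q) \<le> A * t1 powr (-q)"
      using \<open>N * a powr (1 + q) = A\<close> by (intro mult_right_mono) auto
    moreover have "0 < B * t1 powr (p - 1)" using assms by simp
    ultimately show False using \<open>0 < F t1\<close> Nt[OF \<open>0 < t1\<close>] by (simp add: F_def)
  qed
  have "t1 < b"
  proof (rule ccontr)
    assume "\<not> t1 < b"
    then have "B * b powr (p - 2) \<le> B * t1 powr (p - 2)"
      using assms pos by (intro mult_left_mono powr_mono2) auto
    then have "N * t1 \<le> B * t1 powr (p - 2) * t1"
      using \<open>B * b powr (p - 2) = N\<close> \<open>0 < t1\<close> by (intro mult_right_mono) auto
    moreover have "0 < A * t1 powr (-q)" using assms by simp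
    ultimately show False using \<open>0 < F t1\<close> Bt[OF \<open>0 < t1\<close>] by (simp add: F_def)
  qed
  obtain x where x: "a \<le> x" "x \<le> t1" "F x = 0"
    using IVT'[of F a 0 t1] Fa \<open>0 < F t1\<close> \<open>a < t1\<close> cont[OF pos(1)] by auto
  obtain y where y: "t1 \<le> y" "y \<le> b" "F y = 0"
    using IVT2'[of F b 0 t1] Fb \<open>0 < F t1\<close> \<open>t1 < b\<close> cont[OF \<open>0 < t1\<close>] by auto
  have xy: "0 < x" "x < y" using x y pos \<open>0 < F t1\<close> by (auto simp: order_less_le)
  have "t = x \<or> t = y" if "0 < t" "F t = 0" for t
    using no3[of t x y] no3[of x t y] no3[of x y t] that xy x y by (meson linorder_neqE)
  then have "{t \<in> {0<..}. F t = 0} = {x, y}" using xy x y by auto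
  then show ?thesis using xy by simp
qed

text \<open>
  The choice \<open>t = c N^(-1/2)\<close> rescales to unit norm: under the two bounds on \<open>A\<close> and \<open>B\<close> each of the
  three terms is then at most a fixed multiple of \<open>N^(1/2)\<close>, whatever \<open>N\<close> is.  This homogeneity is why a
  single parameter serves all functions.
\<close>

lemma slope_positive_for_uniform_parameter:
  fixes S C p q :: real
  assumes "0 < S" "0 < C" "2 < p" "0 < q" "q \<le> 1"
  obtains lam where "0 < lam"
    "\<And>N A B. \<lbrakk>0 < N; 0 < B; B \<le> S * N powr (p / 2); A \<le> C * B powr ((1 - q) / p)\<rbrakk>
      \<Longrightarrow> \<exists>t>0. 0 < N * t - lam * A * t powr (-q) - B * t powr (p - 1)"
proof -
  \<comment> \<open>Each negative term is made at most one third of the positive one: \<open>c\<close> does it for the term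
    in \<open>B\<close>, and then \<open>lam\<close> for the term in \<open>A\<close>.\<close>
  define c where "c = (1 / (3 * S)) powr (1 / (p - 2))"
  define D where "D = C * S powr ((1 - q) / p)"
  define lam where "lam = c powr (1 + q) / (3 * D)"
  have pos: "0 < c" "0 < D" "0 < lam"
    using assms by (auto simp: c_def D_def lam_def)
  have "S * c powr (p - 2) = 1 / 3" using assms by (simp add: c_def powr_powr)
  moreover have "c powr (p - 1) = c powr (p - 2) * c"
    using pos powr_add[of c "p - 2" 1] by simp
  ultimately have cS: "S * c powr (p - 1) = c / 3" by simp
  have "c powr (1 + q) * c powr (-q) = c"
    using pos by (simp flip: powr_add)
  then have cD: "lam * D * c powr (-q) = c / 3" using pos by (simp add: lam_def)
  have "\<exists>t>0. 0 < N * t - lam * A * t powr (-q) - B * t powr (p - 1)"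
    if h: "0 < N" "0 < B" "B \<le> S * N powr (p / 2)" "A \<le> C * B powr ((1 - q) / p)" for N A B
  proof -
    define t where "t = c * N powr (-1/2)"
    have "0 < t" using pos h by (simp add: t_def)
    have Nt: "N * t = c * N powr (1/2)"
      using h powr_add[of N 1 "-1/2"] by (simp add: t_def)
    have "B powr ((1 - q) / p) \<le> (S * N powr (p / 2)) powr ((1 - q) / p)"
      using h assms by (intro powr_mono2) auto
    also have "\<dots> = S powr ((1 - q) / p) * N powr ((1 - q) / 2)"
      using assms h by (simp add: powr_mult powr_powr)
    finally have "C * B powr ((1 - q) / p) \<le> D * N powr ((1 - q) / 2)"
      using assms by (simp add: D_def mult.assoc)
    then have "A \<le> D * N powr ((1 - q) / 2)" using h by linarith
    have tq: "t powr (-q) = c powr (-q) * N powr (q / 2)"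
      using pos h by (simp add: t_def powr_mult powr_powr)
    have "lam * A * t powr (-q) \<le> lam * (D * N powr ((1 - q) / 2)) * t powr (-q)"
      using pos \<open>A \<le> D * N powr ((1 - q) / 2)\<close> by (intro mult_right_mono mult_left_mono) auto
    also have "\<dots> = (lam * D * c powr (-q)) * N powr ((1 - q) / 2 + q / 2)"
      unfolding powr_add tq by (simp add: ac_simps)
    also have "(1 - q) / 2 + q / 2 = 1 / 2" by (simp add: field_simps)
    finally have 1: "lam * A * t powr (-q) \<le> c / 3 * N powr (1/2)" using cD by simp
    have tp: "t powr (p - 1) = c powr (p - 1) * N powr (- (p - 1) / 2)"
      using pos h by (simp add: t_def powr_mult powr_powr diff_divide_distrib)
    have "B * t powr (p - 1) \<le> S * N powr (p / 2) * t powr (p - 1)"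
      using h by (intro mult_right_mono) auto
    also have "\<dots> = (S * c powr (p - 1)) * N powr (p / 2 + - (p - 1) / 2)"
      unfolding powr_add tp by (simp add: ac_simps)
    also have "p / 2 + - (p - 1) / 2 = 1 / 2" by (simp add: field_simps)
    finally have 2: "B * t powr (p - 1) \<le> c / 3 * N powr (1/2)" using cS by simp
    have "0 < c * N powr (1/2)" using pos h by simp
    then have "0 < N * t - lam * A * t powr (-q) - B * t powr (p - 1)"
      using 1 2 Nt by linarith
    then show ?thesis using \<open>0 < t\<close> by blast
  qed
  then show thesis using that pos by blast
qed

section \<open>The fractional Sobolev inequality\<close>

text \<open>
  On at least half of the ball, \<open>w\<close> is below half its value at the centre, and there the
  numerator is at least \<open>(w x / 2)\<^sup>2\<close> and the denominator at most \<open>r powr \<alpha>\<close>.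
\<close>

lemma half_ball_lower_bound:
  fixes w :: "'a::euclidean_space \<Rightarrow> real"
  assumes [measurable]: "w \<in> borel_measurable borel" and "0 < w x" "0 < r" "0 \<le> \<alpha>"
    and small: "emeasure lborel {y. w x / 2 \<le> w y} \<le> ennreal (measure lborel (ball x r) / 2)"
  shows "ennreal ((w x)\<^sup>2 / 8 * measure lborel (ball x r) * r powr (-\<alpha>))
    \<le> (\<integral>\<^sup>+ y. ennreal (\<bar>w x - w y\<bar>\<^sup>2 / norm (x - y) powr \<alpha>) \<partial>lborel)"
proof -
  define H where "H = {y. w x / 2 \<le> w y}"
  have [measurable]: "H \<in> sets borel" unfolding H_def by measurable
  define c where "c = (w x)\<^sup>2 / 4 * r powr (-\<alpha>)"
  have "0 \<le> c" by (simp add: c_def)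
  have ball: "emeasure lborel (ball x r) = ennreal (measure lborel (ball x r))"
    by (rule emeasure_eq_ennreal_measure) (use emeasure_lborel_ball_finite in \<open>auto simp: less_top\<close>)
  have "ennreal (measure lborel (ball x r) / 2)
      = ennreal (measure lborel (ball x r)) - ennreal (measure lborel (ball x r) / 2)"
    by (subst ennreal_minus) auto
  also have "\<dots> \<le> emeasure lborel (ball x r) - emeasure lborel H"
    unfolding ball using small unfolding H_def by (intro ennreal_mono_minus)
  also have "\<dots> \<le> emeasure lborel (ball x r - H)"
  proof -
    have "emeasure lborel (ball x r) \<le> emeasure lborel (H \<union> (ball x r - H))"
      by (rule emeasure_mono) auto
    also have "\<dots> \<le> emeasure lborel H + emeasure lborel (ball x r - H)"
      by (rule emeasure_subadditive) auto
    finally show ?thesis by (simp add: ennreal_minus_le_iff ball)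
  qed
  finally have D: "ennreal (measure lborel (ball x r) / 2) \<le> emeasure lborel (ball x r - H)" .
  \<comment> \<open>The centre, where the quotient is \<open>0 / 0 = 0\<close>, belongs to \<open>H\<close>.\<close>
  have le: "c * indicator (ball x r - H) y \<le> \<bar>w x - w y\<bar>\<^sup>2 / norm (x - y) powr \<alpha>" for y
  proof (cases "y \<in> ball x r - H")
    case True
    then have y: "w y < w x / 2" "norm (x - y) < r" "x \<noteq> y"
      using \<open>0 < w x\<close> by (auto simp: H_def dist_norm)
    have "(w x / 2)\<^sup>2 \<le> \<bar>w x - w y\<bar>\<^sup>2"
      using y \<open>0 < w x\<close> by (intro power_mono) auto
    moreover have "r powr (-\<alpha>) \<le> norm (x - y) powr (-\<alpha>)"
      using y assms by (intro powr_mono2') auto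
    ultimately have "(w x / 2)\<^sup>2 * r powr (-\<alpha>) \<le> \<bar>w x - w y\<bar>\<^sup>2 * norm (x - y) powr (-\<alpha>)"
      by (intro mult_mono) auto
    then show ?thesis using True by (simp add: c_def powr_minus_divide power_divide)
  qed auto
  have "ennreal ((w x)\<^sup>2 / 8 * measure lborel (ball x r) * r powr (-\<alpha>))
      = ennreal c * ennreal (measure lborel (ball x r) / 2)"
    using \<open>0 \<le> c\<close> by (subst ennreal_mult[symmetric]) (auto simp: c_def)
  also have "\<dots> \<le> ennreal c * emeasure lborel (ball x r - H)"
    using D by (rule mult_left_mono) auto
  also have "\<dots> = (\<integral>\<^sup>+ y. ennreal c * indicator (ball x r - H) y \<partial>lborel)"
    by (subst nn_integral_cmult_indicator) auto
  also have "\<dots> \<le> (\<integral>\<^sup>+ y. ennreal (\<bar>w x - w y\<bar>\<^sup>2 / norm (x - y) powr \<alpha>) \<partial>lborel)"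
  proof (intro nn_integral_mono)
    fix y
    show "ennreal c * indicator (ball x r - H) y
        \<le> ennreal (\<bar>w x - w y\<bar>\<^sup>2 / norm (x - y) powr \<alpha>)"
      using le[of y] by (cases "y \<in> ball x r - H") (simp_all add: ennreal_leI)
  qed
  finally show ?thesis .
qed

text \<open>
  The constant produced by the ball chosen in the proof of the next lemma, not the sharp one.
\<close>

definition sobolev_const :: "real \<Rightarrow> real \<Rightarrow> real" where
  "sobolev_const n s = 8 / unit_ball_vol n
     * (2 powr (2 * n / (n - 2 * s) + 1) / unit_ball_vol n) powr (2 * s / n)"

text \<open>
  A pointwise form of the Sobolev inequality.  Write \<open>h = w x\<close>.  By Markov's inequality the set
  where \<open>w \<ge> h / 2\<close> has measure at most \<open>(2 / h)\<^sup>p M\<close>.  The ball around \<open>x\<close> of twice that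
  volume satisfies the hypothesis of the previous lemma, and its radius is a power of \<open>M / h\<^sup>p\<close>.
  The exponents combine to \<open>h\<^sup>p\<close> exactly because \<open>p\<close> is the critical exponent, for which
  \<open>2 + p (2 s / n) = p\<close>.
\<close>

lemma power_le_nonlocal_gradient:
  fixes w :: "'a::euclidean_space \<Rightarrow> real" and s M :: real
  defines "n \<equiv> real DIM('a)" and "p \<equiv> crit_exp DIM('a) s"
  assumes [measurable]: "w \<in> borel_measurable borel" and w_nonneg: "\<And>y. 0 \<le> w y"
    and "0 < s" "2 * s < n" "0 < M"
    and M: "(\<integral>\<^sup>+ y. ennreal (w y powr p) \<partial>lborel) \<le> ennreal M"
  shows "ennreal (w x powr p) \<le> ennreal (sobolev_const n s * M powr (2 * s / n))
    * (\<integral>\<^sup>+ y. ennreal (\<bar>w x - w y\<bar>\<^sup>2 / norm (x - y) powr (n + 2 * s)) \<partial>lborel)"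
proof (cases "w x = 0")
  case False
  define h where "h = w x"
  define V where "V = unit_ball_vol n"
  have n: "0 < n" by (simp add: n_def)
  have p_eq: "p = 2 * n / (n - 2 * s)" by (simp add: p_def crit_exp_def n_def)
  have "0 < p" using n \<open>2 * s < n\<close> by (simp add: p_eq)
  have p_id: "2 + p * (2 * s / n) = p"
    using n \<open>2 * s < n\<close> by (simp add: p_eq field_simps)
  have pos: "0 < h" "0 < V" using False w_nonneg[of x] n by (auto simp: h_def V_def)
  \<comment> \<open>\<open>T\<close> is \<open>r\<^sup>n\<close>, chosen so that the ball has volume \<open>V T = 2 (2 / h)\<^sup>p M\<close>.\<close>
  define T where "T = 2 powr (p + 1) * M * h powr (-p) / V"
  define r where "r = T powr (1 / n)"
  have "0 < T" "0 < r" using pos \<open>0 < M\<close> by (auto simp: T_def r_def)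
  have rn: "r powr n = T" using \<open>0 < T\<close> n by (simp add: r_def powr_powr)
  have ball: "measure lborel (ball x r) = V * T"
    using \<open>0 < r\<close> rn by (simp add: content_ball V_def n_def powr_realpow)
  have "emeasure lborel {y. w x / 2 \<le> w y} \<le> ennreal (measure lborel (ball x r) / 2)"
  proof -
    have "emeasure lborel {y \<in> UNIV. 1 \<le> ennreal ((h / 2) powr (-p)) * ennreal (w y powr p)}
        \<le> ennreal ((h / 2) powr (-p)) * (\<integral>\<^sup>+ y. ennreal (w y powr p) * indicator UNIV y \<partial>lborel)"
      by (rule nn_integral_Markov_inequality) auto
    also have "\<dots> \<le> ennreal ((h / 2) powr (-p)) * ennreal M"
      using M by (intro mult_left_mono) auto
    also have "\<dots> = ennreal (measure lborel (ball x r) / 2)"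
      using \<open>0 < M\<close> pos unfolding ball
      by (subst ennreal_mult[symmetric])
         (auto simp: T_def powr_divide powr_minus powr_add field_simps)
    also have "{y \<in> UNIV. 1 \<le> ennreal ((h / 2) powr (-p)) * ennreal (w y powr p)}
        = {y. w x / 2 \<le> w y}"
    proof (intro Collect_cong)
      fix y
      have "1 \<le> ennreal ((h / 2) powr (-p)) * ennreal (w y powr p)
          \<longleftrightarrow> 1 \<le> (h / 2) powr (-p) * w y powr p"
        by (subst ennreal_mult[symmetric]) auto
      also have "\<dots> \<longleftrightarrow> (h / 2) powr p \<le> w y powr p"
        using pos by (simp add: powr_minus field_simps)
      also have "\<dots> \<longleftrightarrow> h / 2 \<le> w y"
        using pos \<open>0 < p\<close> w_nonneg[of y] powr_mono2[of p "h / 2" "w y"]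
          powr_less_mono2[of p "w y" "h / 2"] by linarith
      finally show "(y \<in> UNIV \<and> 1 \<le> ennreal ((h / 2) powr (-p)) * ennreal (w y powr p))
          = (w x / 2 \<le> w y)" by (simp add: h_def)
    qed
    finally show ?thesis .
  qed
  then have le: "ennreal (h\<^sup>2 / 8 * measure lborel (ball x r) * r powr (-(n + 2 * s)))
    \<le> (\<integral>\<^sup>+ y. ennreal (\<bar>w x - w y\<bar>\<^sup>2 / norm (x - y) powr (n + 2 * s)) \<partial>lborel)"
    using pos \<open>0 < r\<close> n \<open>0 < s\<close> unfolding h_def
    by (intro half_ball_lower_bound) (auto simp: h_def)
  have "sobolev_const n s * M powr (2 * s / n) * (h\<^sup>2 / 8 * measure lborel (ball x r) * r powr (-(n + 2 * s)))
      = h powr p"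
  proof -
    have "r powr (-(n + 2 * s)) = r powr (-n) * r powr (-(2 * s))"
      by (simp flip: powr_add)
    also have "r powr (-n) = 1 / T" using rn by (simp add: powr_minus_divide)
    also have "r powr (-(2 * s)) = T powr (-(2 * s / n))"
      using \<open>0 < T\<close> by (simp add: r_def powr_powr)
    also have "\<dots> = ((2 powr (p + 1) / V) powr (2 * s / n) * M powr (2 * s / n)
        * h powr (-(p * (2 * s / n)))) powr (-1)"
      using pos \<open>0 < M\<close> by (simp add: T_def powr_mult powr_powr powr_divide powr_minus field_simps)
    also have "\<dots> = h powr (p * (2 * s / n))
        / ((2 powr (p + 1) / V) powr (2 * s / n) * M powr (2 * s / n))"
      using pos \<open>0 < M\<close> by (simp add: powr_minus field_simps)
    finally have r: "r powr (-(n + 2 * s)) = 1 / T * (h powr (p * (2 * s / n))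
        / ((2 powr (p + 1) / V) powr (2 * s / n) * M powr (2 * s / n)))" .
    have const: "sobolev_const n s = 8 / V * (2 powr (p + 1) / V) powr (2 * s / n)"
      by (simp add: sobolev_const_def V_def p_eq)
    have "h powr p = h\<^sup>2 * h powr (p * (2 * s / n))"
      using pos by (subst p_id[symmetric], subst powr_add) (simp add: powr_numeral)
    moreover have "(2 powr (p + 1) / V) powr (2 * s / n) \<noteq> 0" "M powr (2 * s / n) \<noteq> 0"
      using pos \<open>0 < M\<close> by auto
    ultimately show ?thesis
      unfolding r const ball using pos \<open>0 < T\<close> by (simp add: field_simps)
  qed
  then have "ennreal (w x powr p) = ennreal (sobolev_const n s * M powr (2 * s / n))
      * ennreal (h\<^sup>2 / 8 * measure lborel (ball x r) * r powr (-(n + 2 * s)))"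
    using pos n by (subst ennreal_mult[symmetric]) (auto simp: h_def sobolev_const_def)
  also have "\<dots> \<le> ennreal (sobolev_const n s * M powr (2 * s / n))
    * (\<integral>\<^sup>+ y. ennreal (\<bar>w x - w y\<bar>\<^sup>2 / norm (x - y) powr (n + 2 * s)) \<partial>lborel)"
    using le by (rule mult_left_mono) auto
  finally show ?thesis .
qed simp

text \<open>
  Integrating the pointwise bound gives \<open>M \<le> K M^(2s/n) N\<close>, where \<open>2 s / n < 1\<close>, so the power of
  \<open>M\<close> can be absorbed on the left.  This is where the a priori finiteness of the integral is
  needed.
\<close>

lemma fractional_sobolev_of_finite_integral:
  fixes w :: "'a::euclidean_space \<Rightarrow> real" and s :: real
  defines "n \<equiv> real DIM('a)" and "p \<equiv> crit_exp DIM('a) s"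
  assumes [measurable]: "w \<in> borel_measurable borel" and w_nonneg: "\<And>y. 0 \<le> w y"
    and "0 < s" "2 * s < n" "0 \<le> N"
    and finite: "(\<integral>\<^sup>+ y. ennreal (w y powr p) \<partial>lborel) < \<infinity>"
    and seminorm: "(\<integral>\<^sup>+ x. \<integral>\<^sup>+ y. ennreal (\<bar>w x - w y\<bar>\<^sup>2 / norm (x - y) powr (n + 2 * s))
      \<partial>lborel \<partial>lborel) \<le> ennreal N"
  shows "(\<integral>\<^sup>+ y. ennreal (w y powr p) \<partial>lborel) \<le> ennreal ((sobolev_const n s * N) powr (p / 2))"
proof -
  let ?g = "\<lambda>x. \<integral>\<^sup>+ y. ennreal (\<bar>w x - w y\<bar>\<^sup>2 / norm (x - y) powr (n + 2 * s)) \<partial>lborel"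
  have [measurable]: "?g \<in> borel_measurable borel"
    by (subst measurable_lborel2[symmetric], rule lborel.borel_measurable_nn_integral) measurable
  have n: "0 < n" by (simp add: n_def)
  have p_eq: "p = 2 * n / (n - 2 * s)" by (simp add: p_def crit_exp_def n_def)
  have "0 < p" using n \<open>2 * s < n\<close> by (simp add: p_eq)
  let ?K = "sobolev_const n s"
  have "0 \<le> ?K" using n by (simp add: sobolev_const_def)
  obtain M where M: "0 \<le> M" "(\<integral>\<^sup>+ y. ennreal (w y powr p) \<partial>lborel) = ennreal M"
    using finite by (cases "\<integral>\<^sup>+ y. ennreal (w y powr p) \<partial>lborel") auto
  show ?thesis
  proof (cases "M = 0")
    case False
    then have "0 < M" using M by simp
    have "ennreal M \<le> (\<integral>\<^sup>+ x. ennreal (?K * M powr (2 * s / n)) * ?g x \<partial>lborel)"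
      unfolding M(2)[symmetric]
      using power_le_nonlocal_gradient[of w s M] assms(3-6) M \<open>0 < M\<close>
      by (intro nn_integral_mono) (simp add: n_def p_def)
    also have "\<dots> = ennreal (?K * M powr (2 * s / n)) * (\<integral>\<^sup>+ x. ?g x \<partial>lborel)"
      by (rule nn_integral_cmult) simp
    also have "\<dots> \<le> ennreal (?K * M powr (2 * s / n)) * ennreal N"
      using seminorm by (rule mult_left_mono) simp
    also have "\<dots> = ennreal (?K * M powr (2 * s / n) * N)"
      using \<open>0 \<le> ?K\<close> \<open>0 \<le> N\<close> by (subst ennreal_mult[symmetric]) auto
    finally have "M \<le> ?K * M powr (2 * s / n) * N"
      using \<open>0 \<le> ?K\<close> \<open>0 \<le> N\<close> by (subst (asm) ennreal_le_iff) auto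
    moreover have "M = M powr (2 * s / n) * M powr (2 / p)"
    proof -
      have "2 * s / n + 2 / p = 1" using n \<open>2 * s < n\<close> by (simp add: p_eq field_simps)
      then show ?thesis using \<open>0 < M\<close> by (simp flip: powr_add)
    qed
    ultimately have "M powr (2 * s / n) * M powr (2 / p) \<le> M powr (2 * s / n) * (?K * N)"
      by (simp add: mult_ac)
    then have "M powr (2 / p) \<le> ?K * N" using \<open>0 < M\<close> by simp
    then have "(M powr (2 / p)) powr (p / 2) \<le> (?K * N) powr (p / 2)"
      using \<open>0 < p\<close> by (intro powr_mono2) auto
    then have "M \<le> (?K * N) powr (p / 2)"
      using \<open>0 < p\<close> \<open>0 < M\<close> by (simp add: powr_powr)
    then show ?thesis unfolding M(2) by (rule ennreal_leI)
  qed (simp add: M)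
qed

text \<open>
  Truncating \<open>\<bar>v\<bar>\<close> at height \<open>k\<close> makes its \<open>p\<close>-th power integrable, since the support has finite
  measure, and does not increase the seminorm.  The bound does not depend on \<open>k\<close>, so it survives
  monotone convergence.
\<close>

theorem fractional_sobolev:
  fixes v :: "'a::euclidean_space \<Rightarrow> real" and s :: real
  defines "n \<equiv> real DIM('a)" and "p \<equiv> crit_exp DIM('a) s"
  assumes [measurable]: "v \<in> borel_measurable borel"
    and supp: "\<And>x. x \<notin> \<Omega> \<Longrightarrow> v x = 0" and [measurable]: "\<Omega> \<in> sets borel"
    and "emeasure lborel \<Omega> < \<infinity>"
    and "0 < s" "2 * s < n" "0 \<le> N"
    and seminorm: "(\<integral>\<^sup>+ x. \<integral>\<^sup>+ y. ennreal (\<bar>v x - v y\<bar>\<^sup>2 / norm (x - y) powr (n + 2 * s))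
      \<partial>lborel \<partial>lborel) \<le> ennreal N"
  shows "(\<integral>\<^sup>+ y. ennreal (\<bar>v y\<bar> powr p) \<partial>lborel)
    \<le> ennreal ((sobolev_const n s * N) powr (p / 2))"
proof -
  have "0 < p" using \<open>0 < s\<close> \<open>2 * s < n\<close> by (simp add: p_def crit_exp_def n_def)
  define w where "w k x = min \<bar>v x\<bar> (real k)" for k x
  have [measurable]: "w k \<in> borel_measurable borel" for k unfolding w_def by measurable
  have bound: "(\<integral>\<^sup>+ y. ennreal (w k y powr p) \<partial>lborel)
      \<le> ennreal ((sobolev_const n s * N) powr (p / 2))" for k
    unfolding n_def p_def
  proof (rule fractional_sobolev_of_finite_integral)
    have "(\<integral>\<^sup>+ y. ennreal (w k y powr p) \<partial>lborel)
        \<le> (\<integral>\<^sup>+ y. ennreal (real k powr p) * indicator \<Omega> y \<partial>lborel)"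
    proof (intro nn_integral_mono)
      fix y show "ennreal (w k y powr p) \<le> ennreal (real k powr p) * indicator \<Omega> y"
        using \<open>0 < p\<close> supp[of y]
        by (cases "y \<in> \<Omega>") (auto simp: w_def intro!: ennreal_leI powr_mono2)
    qed
    also have "\<dots> = ennreal (real k powr p) * emeasure lborel \<Omega>"
      by (subst nn_integral_cmult_indicator) auto
    also have "\<dots> < \<infinity>"
      using \<open>emeasure lborel \<Omega> < \<infinity>\<close> by (simp add: ennreal_mult_less_top)
    finally show "(\<integral>\<^sup>+ y. ennreal (w k y powr crit_exp DIM('a) s) \<partial>lborel) < \<infinity>"
      by (simp add: p_def)
    have "(\<integral>\<^sup>+ x. \<integral>\<^sup>+ y. ennreal (\<bar>w k x - w k y\<bar>\<^sup>2 / norm (x - y) powr (n + 2 * s))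
        \<partial>lborel \<partial>lborel)
      \<le> (\<integral>\<^sup>+ x. \<integral>\<^sup>+ y. ennreal (\<bar>v x - v y\<bar>\<^sup>2 / norm (x - y) powr (n + 2 * s))
        \<partial>lborel \<partial>lborel)"
      by (intro nn_integral_mono ennreal_leI divide_right_mono power_mono) (auto simp: w_def)
    then show "(\<integral>\<^sup>+ x. \<integral>\<^sup>+ y. ennreal (\<bar>w k x - w k y\<bar>\<^sup>2
        / norm (x - y) powr (real DIM('a) + 2 * s)) \<partial>lborel \<partial>lborel) \<le> ennreal N"
      using seminorm by (simp add: n_def)
  qed (use assms in \<open>auto simp: w_def\<close>)
  have "(\<integral>\<^sup>+ y. ennreal (\<bar>v y\<bar> powr p) \<partial>lborel)
      = (\<integral>\<^sup>+ y. (SUP k. ennreal (w k y powr p)) \<partial>lborel)"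
  proof (intro nn_integral_cong antisym)
    fix y
    obtain k where "\<bar>v y\<bar> \<le> real k" using real_arch_simple by blast
    then have "ennreal (\<bar>v y\<bar> powr p) = ennreal (w k y powr p)" by (simp add: w_def)
    also have "\<dots> \<le> (SUP k. ennreal (w k y powr p))" by (rule SUP_upper) simp
    finally show "ennreal (\<bar>v y\<bar> powr p) \<le> (SUP k. ennreal (w k y powr p))" .
    show "(SUP k. ennreal (w k y powr p)) \<le> ennreal (\<bar>v y\<bar> powr p)"
      using \<open>0 < p\<close> by (intro SUP_least ennreal_leI powr_mono2) (auto simp: w_def)
  qed
  also have "\<dots> = (SUP k. \<integral>\<^sup>+ y. ennreal (w k y powr p) \<partial>lborel)"
    using \<open>0 < p\<close>
    by (intro nn_integral_monotone_convergence_SUP)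
       (auto simp: incseq_def le_fun_def w_def intro!: ennreal_leI powr_mono2)
  also have "\<dots> \<le> ennreal ((sobolev_const n s * N) powr (p / 2))"
    using bound by (rule SUP_least)
  finally show ?thesis .
qed

text \<open>
  The inequality for Borel functions transfers to \<open>X\<^sub>0\<close> through a Borel representative that
  vanishes everywhere outside \<open>\<Omega>\<close>: for it the quotient is zero off \<open>Q\<close>, so the seminorm over \<open>Q\<close>
  is the one over the whole product space, and Tonelli's theorem for the Borel product measure
  turns it into an iterated integral.
\<close>

lemma X0_space_sobolev:
  fixes u :: "'a::euclidean_space \<Rightarrow> real" and s :: real
  defines "n \<equiv> real DIM('a)" and "p \<equiv> crit_exp DIM('a) s"
  assumes "u \<in> X0_space s \<Omega>" "open \<Omega>" "bounded \<Omega>" "0 < s" "2 * s < n"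
  shows "(\<integral>\<^sup>+ x. ennreal (\<bar>u x\<bar> powr p) \<partial>lebesgue_on \<Omega>)
    \<le> ennreal ((sobolev_const n s * (X0_norm s \<Omega> u)\<^sup>2) powr (p / 2))"
proof -
  have [measurable]: "\<Omega> \<in> sets borel" using \<open>open \<Omega>\<close> by simp
  define Q where "Q = Q_set \<Omega>"
  have "open Q"
  proof -
    have "Q = - ((- \<Omega>) \<times> (- \<Omega>))" by (auto simp: Q_def Q_set_def)
    then show ?thesis using \<open>open \<Omega>\<close> by (metis closed_Compl closed_Times open_Compl)
  qed
  then have [measurable]: "Q \<in> sets borel" by simp
  have u: "u \<in> borel_measurable lebesgue" "AE x in lebesgue_on (UNIV - \<Omega>). u x = 0"
    and L2: "L2_on Q (\<lambda>(x, y). (u x - u y) / norm (x - y) powr (n / 2 + s))"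
    using assms by (auto simp: X0_space_def X_space_def Q_def n_def)
  obtain v0 where [measurable]: "v0 \<in> borel_measurable lborel" and v0: "AE x in lborel. u x = v0 x"
    using completion_ex_borel_measurable_real[OF u(1)] by auto
  define v where "v x = v0 x * indicator \<Omega> x" for x
  have [measurable]: "v \<in> borel_measurable borel" unfolding v_def by measurable
  have "AE x in lebesgue. x \<in> UNIV - \<Omega> \<longrightarrow> u x = 0"
    using u(2) by (subst (asm) AE_restrict_space_iff) auto
  then have "AE x in lborel. x \<in> UNIV - \<Omega> \<longrightarrow> u x = 0"
    unfolding AE_completion_iff .
  with v0 have uv: "AE x in lborel. u x = v x"
    by eventually_elim (auto simp: v_def indicator_def)
  \<comment> \<open>An exceptional null set of \<open>u = v\<close> gives a null cross in the product space.\<close>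
  have uv2: "AE z in lborel. u (fst z) = v (fst z) \<and> u (snd z) = v (snd z)"
  proof -
    obtain Z where Z: "{x \<in> space lborel. u x \<noteq> v x} \<subseteq> Z" "Z \<in> null_sets lborel"
      using AE_E[OF uv] by (metis null_setsI)
    have "Z \<times> UNIV \<in> null_sets (lborel \<Otimes>\<^sub>M lborel)" "UNIV \<times> Z \<in> null_sets (lborel \<Otimes>\<^sub>M lborel)"
      using Z by (auto intro: lborel.times_in_null_sets1 lborel.times_in_null_sets2)
    then have "Z \<times> UNIV \<union> UNIV \<times> Z \<in> null_sets (lborel :: ('a \<times> 'a) measure)"
      unfolding lborel_prod by (rule null_sets.Un)
    then show ?thesis by (rule AE_I') (use Z in auto)
  qed
  define f where "f w = (\<lambda>(x, y). \<bar>w x - w y\<bar>\<^sup>2 / norm (x - y) powr (n + 2 * s))"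
    for w :: "'a \<Rightarrow> real"
  define N where "N = (X0_norm s \<Omega> u)\<^sup>2"
  have sq: "((\<lambda>(x, y). (u x - u y) / norm (x - y) powr (n / 2 + s)) z)\<^sup>2 = f u z" for z
  proof -
    have "(c powr (n / 2 + s))\<^sup>2 = c powr (n + 2 * s)" for c :: real
      unfolding power2_eq_square powr_add[symmetric] by (rule arg_cong) simp
    then show ?thesis by (simp add: f_def power_divide split: prod.split)
  qed
  have f_int: "integrable (lebesgue_on Q) (f u)"
    using L2 unfolding L2_on_def sq by simp
  have f_nonneg: "0 \<le> f w z" for w z by (auto simp: f_def split: prod.split)
  have "N = integral\<^sup>L (lebesgue_on Q) (f u)"
    using f_nonneg by (simp add: N_def X0_norm_def Q_def f_def n_def)
  then have "ennreal N = (\<integral>\<^sup>+ z. ennreal (f u z) \<partial>lebesgue_on Q)"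
    using f_int f_nonneg by (subst nn_integral_eq_integral) auto
  also have "\<dots> = (\<integral>\<^sup>+ z. ennreal (f u z) * indicator Q z \<partial>lebesgue)"
    by (subst nn_integral_restrict_space) auto
  also have "\<dots> = (\<integral>\<^sup>+ z. ennreal (f u z) * indicator Q z \<partial>lborel)"
    by (rule nn_integral_completion)
  also have "\<dots> = (\<integral>\<^sup>+ z. ennreal (f v z) \<partial>lborel)"
    using uv2
    by (intro nn_integral_cong_AE, eventually_elim)
       (auto simp: f_def Q_def Q_set_def v_def indicator_def split: prod.splits)
  also have "\<dots> = (\<integral>\<^sup>+ z. ennreal (f v z) \<partial>(lborel \<Otimes>\<^sub>M lborel))"
    by (simp add: lborel_prod)
  also have "\<dots> = (\<integral>\<^sup>+ x. \<integral>\<^sup>+ y. ennreal (f v (x, y)) \<partial>lborel \<partial>lborel)"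
    by (rule lborel.nn_integral_fst[symmetric]) (simp add: f_def)
  finally have N: "(\<integral>\<^sup>+ x. \<integral>\<^sup>+ y. ennreal (\<bar>v x - v y\<bar>\<^sup>2 / norm (x - y) powr (n + 2 * s))
    \<partial>lborel \<partial>lborel) \<le> ennreal N" by (simp add: f_def)
  have "(\<integral>\<^sup>+ x. ennreal (\<bar>u x\<bar> powr p) \<partial>lebesgue_on \<Omega>)
      = (\<integral>\<^sup>+ x. ennreal (\<bar>u x\<bar> powr p) * indicator \<Omega> x \<partial>lborel)"
    by (subst nn_integral_restrict_space) (auto simp: nn_integral_completion)
  also have "\<dots> \<le> (\<integral>\<^sup>+ x. ennreal (\<bar>v x\<bar> powr p) \<partial>lborel)"
    using uv by (intro nn_integral_mono_AE, eventually_elim) (auto simp: indicator_def)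
  also have "\<dots> \<le> ennreal ((sobolev_const n s * N) powr (p / 2))"
    using N assms emeasure_bounded_finite[OF \<open>bounded \<Omega>\<close>]
    unfolding n_def p_def
    by (intro fractional_sobolev[where \<Omega> = \<Omega>]) (auto simp: v_def N_def)
  finally show ?thesis by (simp add: N_def)
qed

section \<open>Lower powers on a finite measure space\<close>

text \<open>
  The first summand covers \<open>x \<le> \<tau>\<close> and the second \<open>x \<ge> \<tau>\<close>.
\<close>

lemma powr_le_threshold_plus_powr:
  fixes x \<tau> r p :: real
  assumes "0 \<le> x" "0 < \<tau>" "0 \<le> r" "r \<le> p"
  shows "x powr r \<le> \<tau> powr r + \<tau> powr (r - p) * x powr p"
proof (cases "x \<le> \<tau>")
  case True
  then have "x powr r \<le> \<tau> powr r" using assms by (intro powr_mono2) auto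
  then show ?thesis by (simp add: add_increasing2)
next
  case False
  then have "x powr (r - p) \<le> \<tau> powr (r - p)"
    using assms by (intro powr_mono2') auto
  then have "x powr (r - p) * x powr p \<le> \<tau> powr (r - p) * x powr p"
    by (rule mult_right_mono) simp
  then show ?thesis using False assms by (simp add: add_increasing flip: powr_add)
qed

text \<open>
  The threshold \<open>\<tau> = B powr (1 / p)\<close> balances the two summands of the pointwise bound and
  yields the exponent of Hoelder's inequality, with a larger constant.
\<close>

lemma lower_power_integral_le:
  fixes u :: "'b \<Rightarrow> real"
  assumes "finite_measure M" and [measurable]: "u \<in> borel_measurable M"
    and int: "integrable M (\<lambda>x. \<bar>u x\<bar> powr p)" and r: "0 \<le> r" "r \<le> p" "0 < p"
  defines "B \<equiv> (\<integral>x. \<bar>u x\<bar> powr p \<partial>M)"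
  shows "integrable M (\<lambda>x. \<bar>u x\<bar> powr r)"
    and "0 < B \<Longrightarrow> (\<integral>x. \<bar>u x\<bar> powr r \<partial>M) \<le> (measure M (space M) + 1) * B powr (r / p)"
proof -
  interpret finite_measure M by fact
  have bound_int: "integrable M (\<lambda>x. \<tau> powr r + \<tau> powr (r - p) * \<bar>u x\<bar> powr p)" for \<tau>
    using int by simp
  \<comment> \<open>Any threshold gives integrability; the estimate below uses the balanced one.\<close>
  show int_r: "integrable M (\<lambda>x. \<bar>u x\<bar> powr r)"
  proof (rule Bochner_Integration.integrable_bound[OF bound_int[of 1]])
    show "AE x in M. norm (\<bar>u x\<bar> powr r) \<le> norm (1 powr r + 1 powr (r - p) * \<bar>u x\<bar> powr p)"
      using powr_le_threshold_plus_powr[of "\<bar>u x\<bar>" 1 r p for x] r by auto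
  qed measurable
  assume "0 < B"
  define \<tau> where "\<tau> = B powr (1 / p)"
  have "0 < \<tau>" using \<open>0 < B\<close> by (simp add: \<tau>_def)
  have "(\<integral>x. \<bar>u x\<bar> powr r \<partial>M) \<le> (\<integral>x. \<tau> powr r + \<tau> powr (r - p) * \<bar>u x\<bar> powr p \<partial>M)"
    using \<open>0 < \<tau>\<close> r by (intro integral_mono int_r bound_int powr_le_threshold_plus_powr) auto
  also have "\<dots> = \<tau> powr r * measure M (space M) + \<tau> powr (r - p) * B"
    using int by (simp add: B_def)
  also have "\<tau> powr (r - p) * B = \<tau> powr r"
  proof -
    have "B = \<tau> powr p" using \<open>0 < B\<close> \<open>0 < p\<close> by (simp add: \<tau>_def powr_powr)
    then show ?thesis by (simp flip: powr_add)
  qed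
  also have "\<tau> powr r = B powr (r / p)" by (simp add: \<tau>_def powr_powr)
  finally show "(\<integral>x. \<bar>u x\<bar> powr r \<partial>M) \<le> (measure M (space M) + 1) * B powr (r / p)"
    by (simp add: algebra_simps)
qed

section \<open>The fiber map and its derivative\<close>

lemma X0_norm_scale:
  "0 \<le> t \<Longrightarrow> X0_norm s \<Omega> (\<lambda>x. t * u x) = t * X0_norm s \<Omega> u"
proof -
  assume "0 \<le> t"
  have "(\<lambda>(x, y). \<bar>t * u x - t * u y\<bar>\<^sup>2 / norm (x - y) powr \<alpha>)
      = (\<lambda>z. t\<^sup>2 * (\<lambda>(x, y). \<bar>u x - u y\<bar>\<^sup>2 / norm (x - y) powr \<alpha>) z)" for \<alpha>
    by (auto simp: fun_eq_iff power_mult_distrib simp flip: right_diff_distrib)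
  then show ?thesis using \<open>0 \<le> t\<close> by (simp add: X0_norm_def real_sqrt_mult)
qed

lemma ereal_integral_eq_integral:
  assumes "AE x in M. g x = ereal (f x)" "integrable M f"
  shows "ereal_integral M g = ereal (integral\<^sup>L M f)"
proof -
  have "(\<integral>\<^sup>+ x. e2ennreal (g x) \<partial>M) = (\<integral>\<^sup>+ x. ennreal (f x) \<partial>M)"
    "(\<integral>\<^sup>+ x. e2ennreal (- g x) \<partial>M) = (\<integral>\<^sup>+ x. ennreal (- f x) \<partial>M)"
    using assms(1) by (auto intro!: nn_integral_cong_AE)
  moreover have "(\<integral>\<^sup>+ x. ennreal (f x) \<partial>M) < top" "(\<integral>\<^sup>+ x. ennreal (- f x) \<partial>M) < top"
    using assms(2) by (auto simp: real_integrable_def less_top)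
  ultimately show ?thesis
    using assms(2) unfolding ereal_integral_def real_lebesgue_integral_def[OF assms(2)]
    by (auto simp: less_top_ennreal)
qed

text \<open>
  The nonlinearity \<open>G\<close> is homogeneous for \<open>q < 1\<close> and turns scaling into addition of \<open>ln t\<close> for
  \<open>q = 1\<close>.  In the second case \<open>\<bar>u\<bar> powr (1 - q)\<close> is the constant \<open>1\<close> almost everywhere (it is
  \<open>0\<close> where \<open>u\<close> vanishes), so that the same integral is the derivative coefficient in both
  cases.
\<close>

lemma ereal_integral_G_scaled:
  fixes a u :: "'b \<Rightarrow> real"
  assumes int: "integrable M (\<lambda>x. a x * \<bar>u x\<bar> powr (1 - q))" and "0 < t"
    and log: "q = 1 \<Longrightarrow> AE x in M. u x \<noteq> 0" "q = 1 \<Longrightarrow> integrable M (\<lambda>x. a x * ln \<bar>u x\<bar>)"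
  shows "ereal_integral M (\<lambda>x. ereal (a x) * G q (t * u x)) =
    ereal (if q = 1 then ln t * (\<integral>x. a x * \<bar>u x\<bar> powr (1 - q) \<partial>M) + (\<integral>x. a x * ln \<bar>u x\<bar> \<partial>M)
      else t powr (1 - q) / (1 - q) * (\<integral>x. a x * \<bar>u x\<bar> powr (1 - q) \<partial>M))"
proof (cases "q = 1")
  case True
  have "AE x in M. ereal (a x) * G q (t * u x)
      = ereal (ln t * (a x * \<bar>u x\<bar> powr (1 - q)) + a x * ln \<bar>u x\<bar>)"
    using log(1)[OF True]
  proof eventually_elim
    case (elim x)
    then show ?case
      using \<open>0 < t\<close> by (simp add: G_def True abs_mult ln_mult algebra_simps)
  qed
  then have "ereal_integral M (\<lambda>x. ereal (a x) * G q (t * u x))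
      = ereal (\<integral>x. ln t * (a x * \<bar>u x\<bar> powr (1 - q)) + a x * ln \<bar>u x\<bar> \<partial>M)"
    by (rule ereal_integral_eq_integral)
       (intro Bochner_Integration.integrable_add integrable_mult_right int log(2) True)
  also have "(\<integral>x. ln t * (a x * \<bar>u x\<bar> powr (1 - q)) + a x * ln \<bar>u x\<bar> \<partial>M)
      = ln t * (\<integral>x. a x * \<bar>u x\<bar> powr (1 - q) \<partial>M) + (\<integral>x. a x * ln \<bar>u x\<bar> \<partial>M)"
    by (subst Bochner_Integration.integral_add)
       (intro integrable_mult_right int log(2) True integral_mult_right_zero
         arg_cong2[where f = "(+)"] refl)+
  finally show ?thesis using True by simp
next
  case False
  have "AE x in M. ereal (a x) * G q (t * u x)
      = ereal (t powr (1 - q) / (1 - q) * (a x * \<bar>u x\<bar> powr (1 - q)))"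
    using \<open>0 < t\<close> False by (simp add: G_def abs_mult powr_mult)
  then have "ereal_integral M (\<lambda>x. ereal (a x) * G q (t * u x))
      = ereal (\<integral>x. t powr (1 - q) / (1 - q) * (a x * \<bar>u x\<bar> powr (1 - q)) \<partial>M)"
    by (rule ereal_integral_eq_integral) (intro integrable_mult_right int)
  then show ?thesis unfolding integral_mult_right_zero using False by simp
qed

lemma integrable_mult_essentially_bounded:
  fixes a f :: "'b \<Rightarrow> real"
  assumes "integrable M f" "a \<in> borel_measurable M" "AE x in M. \<bar>a x\<bar> \<le> m"
  shows "integrable M (\<lambda>x. a x * f x)"
proof (rule Bochner_Integration.integrable_bound)
  show "integrable M (\<lambda>x. m * f x)" using assms by simp
  show "AE x in M. norm (a x * f x) \<le> norm (m * f x)"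
    using assms(3) by eventually_elim (auto simp: abs_mult intro!: mult_right_mono)
qed (use assms in measurable)

text \<open>
  Where \<open>u = 0\<close> the extended-valued \<open>G 1 (u x)\<close> is infinite while the real \<open>ln 0\<close> is \<open>0\<close>; the
  former excludes a zero set of positive measure.
\<close>

lemma L1_ereal_log:
  fixes u :: "'b \<Rightarrow> real"
  assumes "L1_ereal M (\<lambda>x. G 1 (u x))" and [measurable]: "u \<in> borel_measurable M"
  shows "AE x in M. u x \<noteq> 0" "integrable M (\<lambda>x. ln \<bar>u x\<bar>)"
proof -
  have "(\<lambda>x. G 1 (u x)) \<in> borel_measurable M"
    and fin: "(\<integral>\<^sup>+ x. e2ennreal \<bar>G 1 (u x)\<bar> \<partial>M) < \<infinity>"
    using assms by (auto simp: L1_ereal_def)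
  then have "AE x in M. e2ennreal \<bar>G 1 (u x)\<bar> \<noteq> \<infinity>"
    by (intro nn_integral_PInf_AE) auto
  then show "AE x in M. u x \<noteq> 0"
    by eventually_elim (auto simp: G_def)
  have "(\<integral>\<^sup>+ x. ennreal (norm (ln \<bar>u x\<bar>)) \<partial>M) \<le> (\<integral>\<^sup>+ x. e2ennreal \<bar>G 1 (u x)\<bar> \<partial>M)"
    by (intro nn_integral_mono) (simp add: G_def)
  then show "integrable M (\<lambda>x. ln \<bar>u x\<bar>)"
    using fin by (intro integrableI_bounded) auto
qed

lemma critical_point_iff_derivative:
  assumes "\<And>r. 0 < r \<Longrightarrow> \<phi> r = ereal (f r)" "(f has_real_derivative D) (at t)" "0 < t"
  shows "critical_point \<phi> t \<longleftrightarrow> D = 0"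
proof -
  have pos: "\<forall>\<^sub>F r in nhds t. 0 < r"
    using eventually_nhds_in_open[of "{0<..}" t] \<open>0 < t\<close> by simp
  have "\<forall>\<^sub>F r in nhds t. \<bar>\<phi> r\<bar> \<noteq> \<infinity>"
    using pos by eventually_elim (simp add: assms)
  moreover have "((\<lambda>r. real_of_ereal (\<phi> r)) has_real_derivative 0) (at t)
      \<longleftrightarrow> (f has_real_derivative 0) (at t)"
    using pos by (intro DERIV_cong_ev refl) (auto elim!: eventually_mono simp: assms)
  ultimately show ?thesis
    using assms(2) DERIV_unique unfolding critical_point_def by blast
qed

text \<open>
  On \<open>(0, \<infinity>)\<close> the fiber map is an explicit finite function of \<open>t\<close>; the right-hand side is its
  derivative.
\<close>

lemma fiber_map_critical_point_iff:
  fixes s q lam t :: real and u a :: "'a::euclidean_space \<Rightarrow> real" and \<Omega> :: "'a set"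
  defines "p \<equiv> crit_exp DIM('a) s"
  defines "N \<equiv> (X0_norm s \<Omega> u)\<^sup>2"
    and "A \<equiv> (\<integral>x. a x * \<bar>u x\<bar> powr (1 - q) \<partial>lebesgue_on \<Omega>)"
    and "B \<equiv> (\<integral>x. \<bar>u x\<bar> powr p \<partial>lebesgue_on \<Omega>)"
  assumes "0 < p" "0 < t"
    and intA: "integrable (lebesgue_on \<Omega>) (\<lambda>x. a x * \<bar>u x\<bar> powr (1 - q))"
    and intB: "integrable (lebesgue_on \<Omega>) (\<lambda>x. \<bar>u x\<bar> powr p)"
    and log: "q = 1 \<Longrightarrow> AE x in lebesgue_on \<Omega>. u x \<noteq> 0"
      "q = 1 \<Longrightarrow> integrable (lebesgue_on \<Omega>) (\<lambda>x. a x * ln \<bar>u x\<bar>)"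
  shows "critical_point (fiber_map s \<Omega> a q lam u) t
    \<longleftrightarrow> N * t - lam * A * t powr (-q) - B * t powr (p - 1) = 0"
proof (rule critical_point_iff_derivative[OF _ _ \<open>0 < t\<close>])
  let ?L = "\<integral>x. a x * ln \<bar>u x\<bar> \<partial>lebesgue_on \<Omega>"
  define k where "k r = (if q = 1 then ln r * A + ?L else r powr (1 - q) / (1 - q) * A)" for r
  define f where "f r = 1 / 2 * (r\<^sup>2 * N) - lam * k r - 1 / p * (r powr p * B)" for r
  show "fiber_map s \<Omega> a q lam u r = ereal (f r)" if "0 < r" for r
  proof -
    have "ereal_integral (lebesgue_on \<Omega>) (\<lambda>x. ereal (a x) * G q (r * u x)) = ereal (k r)"
      unfolding k_def A_def by (rule ereal_integral_G_scaled[OF intA that log])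
    moreover have "(\<integral>\<^sup>+ x. ennreal (\<bar>r * u x\<bar> powr p) \<partial>lebesgue_on \<Omega>) = ennreal (r powr p * B)"
    proof -
      have "(\<integral>\<^sup>+ x. ennreal (\<bar>r * u x\<bar> powr p) \<partial>lebesgue_on \<Omega>)
          = (\<integral>\<^sup>+ x. ennreal (r powr p * \<bar>u x\<bar> powr p) \<partial>lebesgue_on \<Omega>)"
        using that by (simp add: abs_mult powr_mult)
      also have "\<dots> = ennreal (\<integral>x. r powr p * \<bar>u x\<bar> powr p \<partial>lebesgue_on \<Omega>)"
        using intB by (intro nn_integral_eq_integral) auto
      finally show ?thesis by (simp add: B_def)
    qed
    moreover have "(X0_norm s \<Omega> (\<lambda>x. r * u x))\<^sup>2 = r\<^sup>2 * N"
      using that by (simp add: X0_norm_scale N_def power_mult_distrib)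
    moreover have "0 \<le> B" by (simp add: B_def)
    ultimately show ?thesis
      unfolding fiber_map_def I_functional_def p_def[symmetric]
      by (simp add: f_def)
  qed
  have "(k has_real_derivative A * t powr (-q)) (at t)"
  proof (cases "q = 1")
    case True
    then show ?thesis unfolding k_def using \<open>0 < t\<close>
      by (auto intro!: derivative_eq_intros simp: powr_minus_divide)
  next
    case False
    then show ?thesis unfolding k_def using \<open>0 < t\<close>
      by (auto intro!: derivative_eq_intros)
  qed
  then show "(f has_real_derivative N * t - lam * A * t powr (-q) - B * t powr (p - 1)) (at t)"
    unfolding f_def using \<open>0 < t\<close> \<open>0 < p\<close>
    by (auto intro!: derivative_eq_intros)
qed

section \<open>Positivity of the extremal parameter\<close>

theorem theorem2p3:
  fixes s q :: real and \<Omega> :: "(real ^ 'n) set" and a :: "real ^ 'n \<Rightarrow> real"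
  assumes "0 < s" "s < 1" and "2 * s < real CARD('n)"
    and "smooth_bounded_domain \<Omega>"
    and "Linf_on \<Omega> a"
    and "\<exists>\<theta>>0. AE x in lebesgue_on \<Omega>. \<theta> \<le> a x"
    and "0 < q" "q \<le> 1"
    and "q = 1 \<Longrightarrow> X_plus_q s \<Omega> 1 \<noteq> {}"
  shows "0 < Lambda_sup s \<Omega> a q"
proof -
  define n where "n = real DIM(real ^ 'n)"
  define p where "p = crit_exp DIM(real ^ 'n) s"
  define \<mu> where "\<mu> = lebesgue_on \<Omega>"
  have \<Omega>: "open \<Omega>" "bounded \<Omega>" using assms(4) by (auto simp: smooth_bounded_domain_def)
  have [measurable]: "\<Omega> \<in> sets lebesgue" using \<Omega> by simp
  have n: "0 < n" "2 * s < n" using assms(3) by (auto simp: n_def)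
  have p: "2 < p" using n \<open>0 < s\<close> by (simp add: p_def crit_exp_def n_def field_simps)
  have fin: "finite_measure \<mu>"
    unfolding \<mu>_def using \<Omega>
    by (intro finite_measureI) (simp add: emeasure_restrict_space space_restrict_space
      emeasure_bounded_finite less_imp_neq flip: infinity_ennreal_def)
  obtain \<theta> where \<theta>: "0 < \<theta>" "AE x in \<mu>. \<theta> \<le> a x" using assms(6) unfolding \<mu>_def by blast
  have [measurable]: "a \<in> borel_measurable \<mu>"
    using assms(5) by (simp add: Linf_on_def \<mu>_def)
  obtain m0 where m0: "AE x in \<mu>. \<bar>a x\<bar> \<le> m0"
    using assms(5) unfolding Linf_on_def \<mu>_def by blast
  define m where "m = max m0 1"
  have m: "0 < m" "AE x in \<mu>. \<bar>a x\<bar> \<le> m"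
    using m0 by (auto simp: m_def elim!: eventually_mono)
  define K where "K = sobolev_const n s"
  have "0 < unit_ball_vol n" using n by simp
  then have "0 < K"
    unfolding K_def sobolev_const_def by (intro mult_pos_pos divide_pos_pos) simp_all
  define C where "C = m * (measure \<mu> (space \<mu>) + 1)"
  have "0 < K powr (p / 2)" "0 < C"
    using \<open>0 < K\<close> m by (auto simp: C_def add_nonneg_pos)
  then obtain lam where "0 < lam" and lam:
    "\<And>N A B. \<lbrakk>0 < N; 0 < B; B \<le> K powr (p / 2) * N powr (p / 2); A \<le> C * B powr ((1 - q) / p)\<rbrakk>
      \<Longrightarrow> \<exists>t>0. 0 < N * t - lam * A * t powr (-q) - B * t powr (p - 1)"
    using slope_positive_for_uniform_parameter[OF _ _ p \<open>0 < q\<close> \<open>q \<le> 1\<close>] by metis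
  have "card {t \<in> {0<..}. critical_point (fiber_map s \<Omega> a q lam u) t} = 2"
    if u: "u \<in> X_plus_q s \<Omega> q" for u
  proof -
    have X0: "u \<in> X0_space s \<Omega>" and L1: "L1_ereal \<mu> (\<lambda>x. G q (u x))"
      and nz: "\<not> (AE x in lebesgue. u x = 0)"
      using u by (auto simp: X_plus_q_def X_plus_def \<mu>_def)
    have "u \<in> borel_measurable lebesgue" and out: "AE x in lebesgue_on (UNIV - \<Omega>). u x = 0"
      using X0 by (auto simp: X0_space_def X_space_def)
    then have [measurable]: "u \<in> borel_measurable \<mu>"
      by (simp add: \<mu>_def measurable_restrict_space1)
    \<comment> \<open>The function vanishes outside \<open>\<Omega>\<close>, so it is nonzero inside; this makes \<open>B\<close>, hence \<open>N\<close>, and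
      \<open>A\<close> strictly positive.\<close>
    have nz_\<Omega>: "\<not> (AE x in \<mu>. u x = 0)"
    proof
      assume "AE x in \<mu>. u x = 0"
      then have "AE x in lebesgue. x \<in> \<Omega> \<longrightarrow> u x = 0"
        unfolding \<mu>_def by (subst (asm) AE_restrict_space_iff) auto
      moreover have "AE x in lebesgue. x \<in> UNIV - \<Omega> \<longrightarrow> u x = 0"
        using out by (subst (asm) AE_restrict_space_iff) auto
      ultimately have "AE x in lebesgue. u x = 0" by eventually_elim auto
      then show False using nz by simp
    qed
    define N where "N = (X0_norm s \<Omega> u)\<^sup>2"
    define A where "A = (\<integral>x. a x * \<bar>u x\<bar> powr (1 - q) \<partial>\<mu>)"
    define B where "B = (\<integral>x. \<bar>u x\<bar> powr p \<partial>\<mu>)"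
    have "0 \<le> N" by (simp add: N_def)
    have sob: "(\<integral>\<^sup>+ x. ennreal (\<bar>u x\<bar> powr p) \<partial>\<mu>) \<le> ennreal ((K * N) powr (p / 2))"
      using X0_space_sobolev[OF X0 \<Omega> \<open>0 < s\<close>] n by (simp add: \<mu>_def p_def K_def N_def n_def)
    have intB: "integrable \<mu> (\<lambda>x. \<bar>u x\<bar> powr p)"
      using sob by (intro integrableI_bounded) (auto intro: le_less_trans)
    then have "ennreal B \<le> ennreal ((K * N) powr (p / 2))"
      using sob unfolding B_def by (subst nn_integral_eq_integral[symmetric]) auto
    then have B_le: "B \<le> K powr (p / 2) * N powr (p / 2)"
      using \<open>0 < K\<close> \<open>0 \<le> N\<close> by (simp add: powr_mult)
    have "B \<noteq> 0"
      using nz_\<Omega> p unfolding B_def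
      by (subst integral_nonneg_eq_0_iff_AE[OF intB]) auto
    then have "0 < B" by (simp add: B_def order_less_le)
    then have "N \<noteq> 0" using B_le p by auto
    then have "0 < N" using \<open>0 \<le> N\<close> by simp
    have "0 < p" using p by simp
    have "0 < p" using p by simp
    have r: "0 \<le> 1 - q" "1 - q \<le> p" "0 < p" using \<open>0 < q\<close> \<open>q \<le> 1\<close> p by auto
    have int_low: "integrable \<mu> (\<lambda>x. \<bar>u x\<bar> powr (1 - q))"
      by (rule lower_power_integral_le[OF fin _ intB r]) measurable
    have intA: "integrable \<mu> (\<lambda>x. a x * \<bar>u x\<bar> powr (1 - q))"
      by (rule integrable_mult_essentially_bounded[OF int_low _ m(2)]) measurable
    have "A \<le> (\<integral>x. m * \<bar>u x\<bar> powr (1 - q) \<partial>\<mu>)"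
      unfolding A_def
    proof (rule integral_mono_AE)
      show "AE x in \<mu>. a x * \<bar>u x\<bar> powr (1 - q) \<le> m * \<bar>u x\<bar> powr (1 - q)"
        using m(2) by eventually_elim (auto intro!: mult_right_mono)
    qed (use intA int_low in auto)
    also have "\<dots> \<le> C * B powr ((1 - q) / p)"
      using lower_power_integral_le(2)[OF fin _ intB r] \<open>0 < B\<close> m
      by (simp add: C_def mult.assoc B_def)
    finally have A_le: "A \<le> C * B powr ((1 - q) / p)" .
    have A_nonneg: "AE x in \<mu>. 0 \<le> a x * \<bar>u x\<bar> powr (1 - q)"
      using \<theta>(2) by eventually_elim (use \<theta>(1) in auto)
    have "A \<noteq> 0"
    proof
      assume "A = 0"
      then have "AE x in \<mu>. a x * \<bar>u x\<bar> powr (1 - q) = 0"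
        using integral_nonneg_eq_0_iff_AE[OF intA A_nonneg] by (simp add: A_def)
      then have "AE x in \<mu>. u x = 0"
        using \<theta>(2) by eventually_elim (use \<theta>(1) in auto)
      then show False using nz_\<Omega> by simp
    qed
    moreover have "0 \<le> A" unfolding A_def using A_nonneg by (rule integral_nonneg_AE)
    ultimately have "0 < A" by simp
    have log: "AE x in \<mu>. u x \<noteq> 0" "integrable \<mu> (\<lambda>x. a x * ln \<bar>u x\<bar>)" if "q = 1"
    proof -
      have L1': "L1_ereal \<mu> (\<lambda>x. G 1 (u x))" using L1 that by simp
      show "AE x in \<mu>. u x \<noteq> 0" by (rule L1_ereal_log[OF L1']) measurable
      show "integrable \<mu> (\<lambda>x. a x * ln \<bar>u x\<bar>)"
        by (rule integrable_mult_essentially_bounded[OF _ _ m(2)])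
           (auto intro!: L1_ereal_log[OF L1'])
    qed
    have "critical_point (fiber_map s \<Omega> a q lam u) t
        \<longleftrightarrow> N * t - lam * A * t powr (-q) - B * t powr (p - 1) = 0" if "0 < t" for t
      using \<open>0 < p\<close> that intA intB log unfolding \<mu>_def p_def A_def B_def N_def
      by (rule fiber_map_critical_point_iff)
    then have "{t \<in> {0<..}. critical_point (fiber_map s \<Omega> a q lam u) t}
        = {t \<in> {0<..}. N * t - lam * A * t powr (-q) - B * t powr (p - 1) = 0}"
      by auto
    moreover obtain t1 where "0 < t1"
      "0 < N * t1 - lam * A * t1 powr (-q) - B * t1 powr (p - 1)"
      using lam[OF \<open>0 < N\<close> \<open>0 < B\<close> B_le A_le] by blast
    ultimately show ?thesis
      using two_zeros_of_concave_slope[of N "lam * A" B q p t1]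
        \<open>0 < N\<close> \<open>0 < A\<close> \<open>0 < B\<close> \<open>0 < lam\<close> \<open>0 < q\<close> p by simp
  qed
  then have "ereal lam \<le> Lambda_sup s \<Omega> a q"
    unfolding Lambda_sup_def using \<open>0 < lam\<close> by (intro Sup_upper) blast
  then show ?thesis using \<open>0 < lam\<close> by (meson ereal_less(2) less_le_trans)
qed

end
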